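(* Every $\beta-v$-unfavorable topological space $X$ is a Namioka space.
   Context: For a topological space $X$, $C_p(X)$ denotes the space of all continuous functions $X\to\mathbb R$ with the topology of pointwise convergence (the subspace topology from $\mathbb R^X$ with the product topology). Powers $\mathbb R^S$ carry the product topology. Namioka spaces. For $f:X\times Y\to\mathbb R$, $C(f)$ denotes the set of points of $X\times Y$ at which $f$ is (jointly) continuous. $f$ is separately continuous if it is continuous in each variable when the other is fixed. A mapping $f:X\times Y\to\mathbb R$ has the Namioka property if there exists a dense in $X$ $G_\delta$-set $A\subseteq X$ such that $A\times Y\subseteq C(f)$. A Baire space $X$ is called a Namioka space if for any compact space $Y$, every separately continuous function $f:X\times Y\to\mathbb R$ has the Namioka property. (So a Namioka space is in particular a Baire space.) The $G_{\mathcal P}$-game. Let $\mathcal P$ be a system of subsets of a topological space $X$. Two players $\alpha$ and $\beta$ play on $X$ as follows. The first move of $\beta$ is a nonempty open set $U_0\subseteq X$; the first move of $\alpha$ is a nonempty open set $V_1\subseteq U_0$ together with a set $P_1\in\mathcal P$. Then $\beta$ chooses a nonempty open set $U_1\subseteq V_1$, and $\alpha$ chooses a nonempty open set $V_2\subseteq U_1$ and a set $P_2\in\mathcal P$, and so on. Player $\alpha$ wins if $\left(\bigcap_{n=1}^{\infty}V_n\right)\cap\overline{\bigcup_{n=1}^{\infty}P_n}\neq\emptyset$; otherwise $\beta$ wins. $X$ is $\beta$-unfavorable in the $G_{\mathcal P}$-game if $\beta$ has no winning strategy in this game. Valdivia compacts. The support of a function $z:S\to\mathbb R$ is $\mathrm{supp}\,z=\{s\in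 S: z(s)\neq 0\}$. A compact space is a Valdivia compact if it is homeomorphic to a compact set $Z\subseteq\mathbb R^S$ (for some set $S$) such that $\{z\in Z: |\mathrm{supp}\,z|\le\aleph_0\}$ is dense in $Z$. $\beta-v$-unfavorable spaces. For a system $\mathcal P$ of subsets of $X$ consider the conditions: $(v_1)$ $\mathcal P$ is closed with respect to finite unions; $(v_2)$ for every set $E\in\mathcal P$ and every compact $Y\subseteq C_p(X)$, the compact $\varphi(Y)$ is a Valdivia compact, where $\varphi:C_p(X)\to C_p(E)$, $\varphi(y)=y|_E$. A topological space $X$ is $\beta-v$-unfavorable if there is some system $\mathcal P$ of subsets of $X$ satisfying $(v_1)$ and $(v_2)$ such that $\beta$ has no winning strategy in the $G_{\mathcal P}$-game on $X$. *)

theory Defs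
  imports "HOL-Analysis.Analysis"
begin

text \<open>
  Topological spaces are abstract topologies on a carrier. HOL cannot quantify over types inside
  a formula, so the two notions that mention an arbitrary further space or index set,
  \<open>valdivia_compact\<close> (the index set \<open>S\<close>) and \<open>namioka_space\<close> (the compact factor \<open>Y\<close>), carry the
  type over which that quantifier ranges as an extra argument. A theorem in which these types are
  distinct type variables holds for all of them.
\<close>

subsection \<open>Function spaces\<close>

text \<open>Elements of \<open>powertop_real (topspace X)\<close> are extensional: they are \<open>undefined\<close> off \<open>X\<close>.\<close>

definition Cp :: "'a topology \<Rightarrow> ('a \<Rightarrow> real) topology" where
  "Cp X = subtopology (powertop_real (topspace X)) {f. continuous_map X euclideanreal f}"

subsection \<open>Namioka spaces\<close>

definition dense_in :: "'a topology \<Rightarrow> 'a set \<Rightarrow> bool" where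
  "dense_in X A \<longleftrightarrow> A \<subseteq> topspace X \<and> X closure_of A = topspace X"

text \<open>The intersection with the carrier only matters for the empty family.\<close>

definition baire_space :: "'a topology \<Rightarrow> bool" where
  "baire_space X \<longleftrightarrow>
    (\<forall>\<G>. countable \<G> \<and> (\<forall>G\<in>\<G>. openin X G \<and> dense_in X G) \<longrightarrow>
      dense_in X (topspace X \<inter> \<Inter>\<G>))"

definition separately_continuous ::
  "'a topology \<Rightarrow> 'b topology \<Rightarrow> ('a \<times> 'b \<Rightarrow> real) \<Rightarrow> bool" where
  "separately_continuous X Y f \<longleftrightarrow>
    (\<forall>x\<in>topspace X. continuous_map Y euclideanreal (\<lambda>y. f (x, y))) \<and>
    (\<forall>y\<in>topspace Y. continuous_map X euclideanreal (\<lambda>x. f (x, y)))"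

definition continuity_points ::
  "'a topology \<Rightarrow> 'b topology \<Rightarrow> ('a \<times> 'b \<Rightarrow> real) \<Rightarrow> ('a \<times> 'b) set" where
  "continuity_points X Y f =
    {p \<in> topspace X \<times> topspace Y. topcontinuous_at (prod_topology X Y) euclideanreal f p}"

definition namioka_property ::
  "'a topology \<Rightarrow> 'b topology \<Rightarrow> ('a \<times> 'b \<Rightarrow> real) \<Rightarrow> bool" where
  "namioka_property X Y f \<longleftrightarrow>
    (\<exists>A. dense_in X A \<and> gdelta_in X A \<and> A \<times> topspace Y \<subseteq> continuity_points X Y f)"

definition namioka_space :: "'y itself \<Rightarrow> 'a topology \<Rightarrow> bool" where
  "namioka_space _ X \<longleftrightarrow>
    baire_space X \<and>
    (\<forall>(Y :: 'y topology) f. compact_space Y \<and> separately_continuous X Y f \<longrightarrow>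
      namioka_property X Y f)"

subsection \<open>The game\<close>

text \<open>
  A position at which \<open>\<beta>\<close> is to move is the list \<open>[(V\<^sub>1, P\<^sub>1), \<dots>, (V\<^sub>n, P\<^sub>n)]\<close> of the moves \<open>\<alpha>\<close> has
  made so far, and a strategy \<open>\<sigma>\<close> of \<open>\<beta>\<close> maps it to the next set \<open>U\<^sub>n\<close>; the earlier moves of \<open>\<beta>\<close>
  are determined by \<open>\<sigma>\<close>. The positions that arise when \<open>\<beta>\<close> follows \<open>\<sigma>\<close> and \<open>\<alpha>\<close> moves legally:
\<close>

inductive game_position ::
  "'a topology \<Rightarrow> 'a set set \<Rightarrow> (('a set \<times> 'a set) list \<Rightarrow> 'a set)
    \<Rightarrow> ('a set \<times> 'a set) list \<Rightarrow> bool"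
  for X \<P> \<sigma> where
  start: "game_position X \<P> \<sigma> []"
| alpha_move: "\<lbrakk>game_position X \<P> \<sigma> h; openin X V; V \<noteq> {}; V \<subseteq> \<sigma> h; P \<in> \<P>\<rbrakk>
    \<Longrightarrow> game_position X \<P> \<sigma> (h @ [(V, P)])"

definition beta_strategy ::
  "'a topology \<Rightarrow> 'a set set \<Rightarrow> (('a set \<times> 'a set) list \<Rightarrow> 'a set) \<Rightarrow> bool" where
  "beta_strategy X \<P> \<sigma> \<longleftrightarrow>
    (\<forall>h. game_position X \<P> \<sigma> h \<longrightarrow>
      openin X (\<sigma> h) \<and> \<sigma> h \<noteq> {} \<and> (h \<noteq> [] \<longrightarrow> \<sigma> h \<subseteq> fst (last h)))"

text \<open>In an infinite play \<open>m\<close>, the pair \<open>m n\<close> is the move \<open>(V\<^bsub>n+1\<^esub>, P\<^bsub>n+1\<^esub>)\<close>.\<close>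

definition beta_winning_strategy ::
  "'a topology \<Rightarrow> 'a set set \<Rightarrow> (('a set \<times> 'a set) list \<Rightarrow> 'a set) \<Rightarrow> bool" where
  "beta_winning_strategy X \<P> \<sigma> \<longleftrightarrow>
    beta_strategy X \<P> \<sigma> \<and>
    (\<forall>m :: nat \<Rightarrow> 'a set \<times> 'a set.
      (\<forall>n. game_position X \<P> \<sigma> (map m [0..<n])) \<longrightarrow>
      (\<Inter>n. fst (m n)) \<inter> (X closure_of (\<Union>n. snd (m n))) = {})"

definition beta_unfavorable :: "'a topology \<Rightarrow> 'a set set \<Rightarrow> bool" where
  "beta_unfavorable X \<P> \<longleftrightarrow> \<not> (\<exists>\<sigma>. beta_winning_strategy X \<P> \<sigma>)"

subsection \<open>Valdivia compacts and the main notion\<close>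

text \<open>Off \<open>S\<close> an element of \<open>powertop_real S\<close> is \<open>undefined\<close>, so the support is taken within \<open>S\<close>.\<close>

definition supp_on :: "'s set \<Rightarrow> ('s \<Rightarrow> real) \<Rightarrow> 's set" where
  "supp_on S z = {s \<in> S. z s \<noteq> 0}"

definition valdivia_compact :: "'s itself \<Rightarrow> 'b topology \<Rightarrow> bool" where
  "valdivia_compact _ K \<longleftrightarrow>
    compact_space K \<and>
    (\<exists>(S :: 's set) Z.
      compactin (powertop_real S) Z \<and>
      K homeomorphic_space subtopology (powertop_real S) Z \<and>
      dense_in (subtopology (powertop_real S) Z) {z \<in> Z. countable (supp_on S z)})"

definition beta_v_unfavorable :: "'s itself \<Rightarrow> 'a topology \<Rightarrow> bool" where
  "beta_v_unfavorable s X \<longleftrightarrow>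
    (\<exists>\<P>. (\<forall>E\<in>\<P>. E \<subseteq> topspace X) \<and>
      (\<forall>\<F>. finite \<F> \<and> \<F> \<noteq> {} \<and> \<F> \<subseteq> \<P> \<longrightarrow> \<Union>\<F> \<in> \<P>) \<and>
      (\<forall>E\<in>\<P>. \<forall>Y. compactin (Cp X) Y \<longrightarrow>
        valdivia_compact s
          (subtopology (Cp (subtopology X E)) ((\<lambda>y. restrict y E) ` Y))) \<and>
      beta_unfavorable X \<P>)"

end

theory Submission
  imports Defs
begin

text \<open>
  If \<open>f\<close> oscillates by more than \<open>8\<delta>\<close> in \<open>x\<close>, for some \<open>y\<close>, on every nonempty open subset of \<open>W\<close>,
  then \<open>\<beta>\<close> can answer the moves \<open>(V\<^sub>i, P\<^sub>i)\<close> with points \<open>y\<^sub>n, z\<^sub>n\<close> and a set \<open>U\<^sub>n\<close> such that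
  \<open>f(\<cdot>, y\<^sub>n) = f(\<cdot>, z\<^sub>n)\<close> on \<open>P\<^sub>1 \<union> \<dots> \<union> P\<^sub>n\<close> but \<open>\<bar>f(\<cdot>, y\<^sub>n) - f(\<cdot>, z\<^sub>n)\<bar> > \<delta>\<close> on \<open>U\<^sub>n\<close>; a cluster point of
  \<open>(y\<^sub>n, z\<^sub>n)\<close> then shows that \<open>\<beta>\<close> wins. Such pairs exist because otherwise \<open>\<delta>\<close> bounds the difference
  of \<open>f\<close> along the fibres of the map \<open>\<psi>\<close> of \<open>Y\<close> onto a Valdivia compact. In that case \<open>\<beta>\<close> wins by a
  second strategy: he picks \<open>y\<^sub>n, z\<^sub>n\<close> with \<open>\<psi>\<close>-images of countable support that are close on finitely
  many coordinates, and exhausts all these supports, so that a cluster point lies in a single fibre.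
\<close>

section \<open>Cluster points and finite nets in compact spaces\<close>

text \<open>The closures of the tails are nested, nonempty and closed, so compactness gives a common
  point. Clustering is stated through closed sets because sequences in these compact spaces need not
  have convergent subsequences.\<close>

lemma compact_space_cluster_point:
  fixes a :: "nat \<Rightarrow> 'y"
  assumes K: "compact_space K" and a: "\<And>n. a n \<in> topspace K"
  shows "\<exists>p\<in>topspace K. \<forall>C N. closedin K C \<and> (\<forall>n\<ge>N. a n \<in> C) \<longrightarrow> p \<in> C"
proof -
  define T where "T N = K closure_of (a ` {N..})" for N
  have sub: "a ` {N..} \<subseteq> T N" for N
    unfolding T_def by (rule closure_of_subset) (use a in auto)
  have "\<Inter>(range T) \<noteq> {}"
  proof (rule compact_space_imp_nest[OF K])
    show "closedin K (T n)" for n by (simp add: T_def)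
    show "T n \<noteq> {}" for n using sub[of n] by auto
    show "decseq T"
      unfolding T_def by (intro decseq_SucI closure_of_mono image_mono) auto
  qed
  then obtain p where p: "\<And>N. p \<in> T N" by blast
  show ?thesis
  proof (intro bexI allI impI, elim conjE)
    show "p \<in> topspace K"
      using p[of 0] by (simp add: T_def in_closure_of)
    fix C N assume "closedin K C" "\<forall>n\<ge>N. a n \<in> C"
    then have "T N \<subseteq> C"
      unfolding T_def by (intro closure_of_minimal) auto
    with p show "p \<in> C" by blast
  qed
qed

text \<open>Total boundedness for finitely many functions. The net has to lie in \<open>D\<close>,
  which need not be closed: in the application \<open>D\<close> consists of the points whose image
  has countable support.\<close>

lemma compact_space_finite_approximation:
  fixes g :: "'s \<Rightarrow> 'y \<Rightarrow> real"
  assumes K: "compact_space K" and F: "finite F" and D: "D \<subseteq> topspace K"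
    and cont: "\<And>s. s \<in> F \<Longrightarrow> continuous_map K euclideanreal (g s)" and "\<eta> > 0"
  obtains N where "finite N" "N \<subseteq> D" "\<And>y. y \<in> D \<Longrightarrow> \<exists>d\<in>N. \<forall>s\<in>F. \<bar>g s y - g s d\<bar> < \<eta>"
proof -
  \<comment> \<open>For empty \<open>F\<close> the indexed intersection is everything, hence the
    factor \<open>topspace K\<close>.\<close>
  define O' where "O' u = topspace K \<inter> (\<Inter>s\<in>F. {y \<in> topspace K. g s y \<in> ball (g s u) (\<eta>/2)})" for u
  have "openin K (O' u)" for u
  proof (cases "F = {}")
    case False
    have "openin K {y \<in> topspace K. g s y \<in> ball (g s u) (\<eta>/2)}" if "s \<in> F" for s
      by (rule openin_continuous_map_preimage[OF cont[OF that]]) simp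
    with False show ?thesis
      unfolding O'_def
      by (intro openin_Int openin_topspace openin_Inter finite_imageI F) blast+
  qed (simp add: O'_def)
  moreover have "u \<in> O' u" if "u \<in> topspace K" for u
    using that \<open>\<eta> > 0\<close> by (auto simp: O'_def)
  ultimately have "\<exists>\<F>. finite \<F> \<and> \<F> \<subseteq> O' ` topspace K \<and> topspace K \<subseteq> \<Union>\<F>"
    by (intro K[unfolded compact_space_alt, rule_format]) auto
  then obtain M where M: "finite M" "M \<subseteq> topspace K" "topspace K \<subseteq> (\<Union>u\<in>M. O' u)"
    by (metis finite_subset_image)
  \<comment> \<open>The centres \<open>u\<close> may lie outside \<open>D\<close>; each one whose
    \<open>O' u\<close> meets \<open>D\<close> is replaced by a point of \<open>D\<close> in
    \<open>O' u\<close>, at the price of a second \<open>\<eta>/2\<close>.\<close>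
  define N where "N = (\<lambda>u. SOME d. d \<in> D \<inter> O' u) ` {u \<in> M. D \<inter> O' u \<noteq> {}}"
  have pick: "(SOME d. d \<in> D \<inter> O' u) \<in> D \<inter> O' u" if "D \<inter> O' u \<noteq> {}" for u
    using that by (metis ex_in_conv someI_ex)
  show ?thesis
  proof
    show "finite N" using M by (simp add: N_def)
    show "N \<subseteq> D" unfolding N_def using pick by blast
    fix y assume y: "y \<in> D"
    then obtain u where u: "u \<in> M" "y \<in> O' u" using M D by blast
    define d where "d = (SOME d. d \<in> D \<inter> O' u)"
    have d: "d \<in> N" "d \<in> O' u" using u y pick[of u] by (auto simp: N_def d_def)
    have "\<bar>g s y - g s d\<bar> < \<eta>" if "s \<in> F" for s
    proof -
      have "dist (g s u) (g s y) < \<eta>/2" "dist (g s u) (g s d) < \<eta>/2"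
        using that u(2) d(2) by (auto simp: O'_def)
      then show ?thesis unfolding dist_real_def by linarith
    qed
    with d show "\<exists>d\<in>N. \<forall>s\<in>F. \<bar>g s y - g s d\<bar> < \<eta>" by blast
  qed
qed

section \<open>Plays that \<beta> does not win, and the Baire property\<close>

text \<open>
  Strategies of \<open>\<beta>\<close> are described by a transition system: \<open>out s\<close> is the set played in state \<open>s\<close>,
  and \<open>R s P s'\<close> is a property that \<open>\<beta>\<close> can enforce for the state following a move \<open>(V, P)\<close>.
\<close>

lemma beta_unfavorable_play:
  fixes I :: "'st \<Rightarrow> bool"
  assumes unf: "beta_unfavorable X \<P>" and init: "I s0"
    and out: "\<And>s. I s \<Longrightarrow> openin X (out s) \<and> out s \<noteq> {}"
    and step: "\<And>s V P. \<lbrakk>I s; openin X V; V \<noteq> {}; V \<subseteq> out s; P \<in> \<P>\<rbrakk>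
      \<Longrightarrow> \<exists>s'. I s' \<and> out s' \<subseteq> V \<and> R s P s'"
  obtains st P x where "st 0 = s0" "\<And>n. I (st n)" "\<And>n. P n \<in> \<P>"
    "\<And>n. R (st n) (P n) (st (Suc n))" "\<And>n. x \<in> out (st n)" "x \<in> X closure_of (\<Union>n. P n)"
proof -
  define nxt where "nxt s m = (SOME s'. I s' \<and> out s' \<subseteq> fst m \<and> R s (snd m) s')" for s m
  \<comment> \<open>The state is recomputed from the moves of \<alpha> alone, which is all that
    \<open>\<sigma>\<close> may depend on.\<close>
  define run where "run h = foldl nxt s0 h" for h
  define \<sigma> where "\<sigma> h = out (run h)" for h
  have nxt: "I (nxt s (V, P)) \<and> out (nxt s (V, P)) \<subseteq> V \<and> R s P (nxt s (V, P))"
    if "I s" "openin X V" "V \<noteq> {}" "V \<subseteq> out s" "P \<in> \<P>" for s V P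
    unfolding nxt_def using someI_ex[OF step[OF that]] by simp
  have run_snoc: "run (h @ [m]) = nxt (run h) m" for h m
    by (simp add: run_def)
  have pos: "I (run h) \<and> (h \<noteq> [] \<longrightarrow> \<sigma> h \<subseteq> fst (last h))" if "game_position X \<P> \<sigma> h" for h
    using that
  proof induction
    case start
    then show ?case by (simp add: run_def init)
  next
    case (alpha_move h V P)
    then show ?case using nxt[of "run h" V P] by (simp add: run_snoc \<sigma>_def)
  qed
  then have "beta_strategy X \<P> \<sigma>"
    unfolding beta_strategy_def using out by (auto simp: \<sigma>_def)
  with unf obtain m where m: "\<And>n. game_position X \<P> \<sigma> (map m [0..<n])"
    and ne: "(\<Inter>n. fst (m n)) \<inter> (X closure_of (\<Union>n. snd (m n))) \<noteq> {}"
    unfolding beta_unfavorable_def beta_winning_strategy_def by metis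
  then obtain x where x: "\<And>n. x \<in> fst (m n)" "x \<in> X closure_of (\<Union>n. snd (m n))"
    by auto
  define st where "st n = run (map m [0..<n])" for n
  have st_Suc: "st (Suc n) = nxt (st n) (fst (m n), snd (m n))" for n
    by (simp add: st_def run_snoc)
  \<comment> \<open>Inverting position \<open>n + 1\<close> shows that its last move
    \<open>m n\<close> was legal at position \<open>n\<close>.\<close>
  have legal: "openin X (fst (m n)) \<and> fst (m n) \<noteq> {} \<and> fst (m n) \<subseteq> out (st n) \<and> snd (m n) \<in> \<P>" for n
    using m[of "Suc n"] by (cases rule: game_position.cases) (auto simp: \<sigma>_def st_def)
  have I: "I (st n)" for n
    using pos[OF m] by (simp add: st_def)
  show ?thesis
  proof (rule that[of st "\<lambda>n. snd (m n)" x])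
    show "st 0 = s0" by (simp add: st_def run_def)
    show "R (st n) (snd (m n)) (st (Suc n))" for n
      unfolding st_Suc using nxt[OF I[of n]] legal[of n] by blast
    show "x \<in> out (st n)" for n
      using legal[of n] x(1)[of n] by blast
  qed (use I legal x in auto)
qed

text \<open>\<beta> opens with \<open>W\<close> and intersects each move of \<alpha> with the next
  dense open set. This strategy does not win, so some play has a point common to all its
  sets.\<close>

lemma beta_unfavorable_imp_baire:
  assumes unf: "beta_unfavorable X \<P>"
  shows "baire_space X"
  unfolding baire_space_def
proof (intro allI impI, elim conjE)
  fix \<G> :: "'a set set"
  assume cnt: "countable \<G>" and \<G>: "\<forall>G\<in>\<G>. openin X G \<and> dense_in X G"
  have "x \<in> X closure_of (topspace X \<inter> \<Inter>\<G>)" if x: "x \<in> topspace X" for x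
    unfolding in_closure_of
  proof (intro conjI allI impI x, elim conjE)
    fix W assume W: "x \<in> W" "openin X W"
    show "\<exists>y. y \<in> topspace X \<inter> \<Inter>\<G> \<and> y \<in> W"
    proof (cases "\<G> = {}")
      case True
      with W x show ?thesis by auto
    next
      case False
      define G where "G n = from_nat_into \<G> n" for n
      have G: "openin X (G n)" "X closure_of (G n) = topspace X" for n
        using \<G> from_nat_into[OF False, of n] by (auto simp: G_def dense_in_def)
      have rG: "range G = \<G>"
        using False cnt by (simp add: G_def[abs_def] range_from_nat_into)
      define I where "I = (\<lambda>(n :: nat, U). openin X U \<and> U \<noteq> {} \<and> U \<subseteq> W)"
      define R where "R = (\<lambda>(n, U :: 'a set) (P :: 'a set) (n', U'). n' = Suc n \<and> U' \<subseteq> G n)"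
      obtain st P y where st0: "st 0 = (0, W)" and "\<And>n. I (st n)" and "\<And>n. P n \<in> \<P>"
        and stR: "\<And>n. R (st n) (P n) (st (Suc n))" and y: "\<And>n. y \<in> snd (st n)"
      proof (rule beta_unfavorable_play[OF unf, of I "(0, W)" snd R])
        show "I (0, W)" using W by (auto simp: I_def)
        show "openin X (snd s) \<and> snd s \<noteq> {}" if "I s" for s
          using that by (auto simp: I_def)
        fix s V and P :: "'a set"
        assume s: "I s" and V: "openin X V" "V \<noteq> {}" "V \<subseteq> snd s"
        obtain n U where nU: "s = (n, U)" by fastforce
        have "V \<inter> G n \<noteq> {}"
          using V openin_subset[OF V(1)] G(2)[of n] openin_Int_closure_of_eq_empty[OF V(1), of "G n"]
          by auto
        moreover have "openin X (V \<inter> G n)" using V G by auto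
        ultimately show "\<exists>s'. I s' \<and> snd s' \<subseteq> V \<and> R s P s'"
          using s V by (intro exI[of _ "(Suc n, V \<inter> G n)"]) (auto simp: I_def R_def nU)
      qed blast
      have fst: "fst (st n) = n" for n
        by (induction n) (use st0 stR in \<open>auto simp: R_def split_beta\<close>)
      have "y \<in> G n" for n
        using stR[of n] y[of "Suc n"] by (auto simp: R_def split_beta fst)
      then have "y \<in> \<Inter>\<G>" using rG by auto
      moreover have "y \<in> W" using y[of 0] st0 by simp
      ultimately show ?thesis using openin_subset[OF W(2)] by blast
    qed
  qed
  then show "dense_in X (topspace X \<inter> \<Inter>\<G>)"
    unfolding dense_in_def using closure_of_subset_topspace by fast
qed

section \<open>Oscillation along the fibres over a Valdivia compact\<close>

text \<open>The image of \<open>C\<close> is compact, hence closed in the Hausdorff space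
  \<open>Z\<close>, and it contains a dense set. For non-injective \<open>\<psi>\<close> this says
  that \<open>C\<close> meets every fibre, not that \<open>C\<close> is all of
  \<open>Y\<close>.\<close>

lemma image_eq_of_dense_subset:
  assumes "Hausdorff_space Z" "continuous_map Y Z \<psi>" "compact_space Y" "closedin Y C"
    and dense: "dense_in (subtopology Z (\<psi> ` topspace Y)) T" and "T \<subseteq> \<psi> ` C"
  shows "\<psi> ` C = \<psi> ` topspace Y"
proof -
  let ?Z = "subtopology Z (\<psi> ` topspace Y)"
  have C: "C \<subseteq> topspace Y" by (simp add: assms closedin_subset)
  have "compactin Z (\<psi> ` C)"
    using assms closedin_compact_space image_compactin by blast
  then have "closedin Z (\<psi> ` C)"
    using assms compactin_imp_closedin by blast
  then have "closedin ?Z (\<psi> ` C)"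
    using C by (meson closedin_subset_topspace image_mono)
  then have "?Z closure_of T \<subseteq> \<psi> ` C"
    by (rule closure_of_minimal[OF \<open>T \<subseteq> \<psi> ` C\<close>])
  moreover have "?Z closure_of T = \<psi> ` topspace Y"
    using dense continuous_map_image_subset_topspace[OF assms(2)] by (auto simp: dense_in_def)
  ultimately show ?thesis using C by auto
qed

lemma finite_continuous_small_oscillation:
  fixes g :: "'i \<Rightarrow> 'a \<Rightarrow> real"
  assumes "finite N" "\<And>i. i \<in> N \<Longrightarrow> continuous_map X euclideanreal (g i)"
    and V: "openin X V" "V \<noteq> {}" and "\<eta> > 0"
  obtains U where "openin X U" "U \<noteq> {}" "U \<subseteq> V"
    "\<And>i x x'. \<lbrakk>i \<in> N; x \<in> U; x' \<in> U\<rbrakk> \<Longrightarrow> \<bar>g i x - g i x'\<bar> < \<eta>"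
proof -
  obtain x0 where x0: "x0 \<in> V" using V by blast
  define U where "U = V \<inter> topspace X \<inter> (\<Inter>i\<in>N. {x \<in> topspace X. g i x \<in> ball (g i x0) (\<eta>/2)})"
  show ?thesis
  proof
    show "openin X U"
    proof (cases "N = {}")
      case False
      have "openin X {x \<in> topspace X. g i x \<in> ball (g i x0) (\<eta>/2)}" if "i \<in> N" for i
        by (rule openin_continuous_map_preimage[OF assms(2)[OF that]]) simp
      with False show ?thesis
        unfolding U_def using V assms(1)
        by (intro openin_Int openin_topspace openin_Inter finite_imageI) blast+
    qed (use V in \<open>auto simp: U_def\<close>)
    show "U \<noteq> {}"
      using x0 V openin_subset[OF V(1)] \<open>\<eta> > 0\<close> by (auto simp: U_def)
    show "U \<subseteq> V" by (auto simp: U_def)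
    fix i x x' assume *: "i \<in> N" "x \<in> U" "x' \<in> U"
    then have "dist (g i x0) (g i x) < \<eta>/2" "dist (g i x0) (g i x') < \<eta>/2"
      by (auto simp: U_def)
    then show "\<bar>g i x - g i x'\<bar> < \<eta>" unfolding dist_real_def by linarith
  qed
qed

text \<open>
  The conclusion fails for injective \<open>\<psi>\<close>; in this case the lemma is the theorem that Valdivia
  compacts are co-Namioka.
\<close>

lemma separated_pair_in_valdivia_fibre:
  fixes f :: "'a \<times> 'y \<Rightarrow> real" and \<psi> :: "'y \<Rightarrow> 's \<Rightarrow> real"
  assumes unf: "beta_unfavorable X \<P>" and Y: "compact_space Y"
    and f: "separately_continuous X Y f"
    and \<psi>: "continuous_map Y (powertop_real S) \<psi>"
    and dense: "dense_in (subtopology (powertop_real S) (\<psi> ` topspace Y))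
      {z \<in> \<psi> ` topspace Y. countable (supp_on S z)}"
    and \<delta>: "\<delta> > 0" and W: "openin X W" "W \<noteq> {}"
    and osc: "\<And>U. \<lbrakk>openin X U; U \<noteq> {}; U \<subseteq> W\<rbrakk>
      \<Longrightarrow> \<exists>y\<in>topspace Y. \<exists>x\<in>U. \<exists>x'\<in>U. \<bar>f (x, y) - f (x', y)\<bar> > 8 * \<delta>"
  shows "\<exists>y\<in>topspace Y. \<exists>z\<in>topspace Y. \<psi> y = \<psi> z \<and> (\<exists>x\<in>W. \<bar>f (x, y) - f (x, z)\<bar> > \<delta>)"
proof (rule ccontr)
  assume "\<not> ?thesis"
  then have fib: "\<bar>f (x, y) - f (x, z)\<bar> \<le> \<delta>"
    if "y \<in> topspace Y" "z \<in> topspace Y" "\<psi> y = \<psi> z" "x \<in> W" for x y z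
    using that by (meson not_le)
  have contY: "continuous_map Y euclideanreal (\<lambda>y. f (x, y))" if "x \<in> topspace X" for x
    using f that by (auto simp: separately_continuous_def)
  have contX: "continuous_map X euclideanreal (\<lambda>x. f (x, y))" if "y \<in> topspace Y" for y
    using f that by (auto simp: separately_continuous_def)
  have WX: "W \<subseteq> topspace X" using W openin_subset by blast
  have cont\<psi>: "continuous_map Y euclideanreal (\<lambda>y. \<psi> y s)" if "s \<in> S" for s
    using \<psi> that by (simp add: continuous_map_componentwise)
  \<comment> \<open>Only the image of \<open>D\<close> is known to be dense; \<open>D\<close> itself
    need not be dense in \<open>Y\<close>.\<close>
  define D where "D = {y \<in> topspace Y. countable (supp_on S (\<psi> y))}"
  have DY: "D \<subseteq> topspace Y" by (auto simp: D_def)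
  \<comment> \<open>If no point of \<open>D\<close> worked, \<open>D\<close> would lie in the closed
    set \<open>C\<close>, and \<open>C\<close> would meet the fibre of \<open>y\<close>. Moving
    inside this fibre costs \<open>\<delta>\<close> at each of \<open>x\<close> and
    \<open>x'\<close>, hence \<open>6 * \<delta>\<close> in place of
    \<open>8 * \<delta>\<close>.\<close>
  have oscD: "\<exists>y\<in>D. \<exists>x\<in>U. \<exists>x'\<in>U. \<bar>f (x, y) - f (x', y)\<bar> > 6 * \<delta>"
    if U: "openin X U" "U \<noteq> {}" "U \<subseteq> W" for U
  proof -
    obtain y x x' where y: "y \<in> topspace Y" "x \<in> U" "x' \<in> U" "\<bar>f (x, y) - f (x', y)\<bar> > 8 * \<delta>"
      using osc[OF U] by blast
    define C where "C = {y \<in> topspace Y. f (x, y) - f (x', y) \<in> {-6*\<delta>..6*\<delta>}}"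
    have "x \<in> topspace X" "x' \<in> topspace X" using y U WX by auto
    then have C: "closedin Y C"
      unfolding C_def
      by (intro closedin_continuous_map_preimage[where Y=euclideanreal] continuous_map_diff contY) auto
    show ?thesis
    proof (rule ccontr)
      assume "\<not> ?thesis"
      then have "\<bar>f (x, d) - f (x', d)\<bar> \<le> 6 * \<delta>" if "d \<in> D" for d
        using that y by (meson not_le)
      then have "D \<subseteq> C" using DY by (force simp: C_def abs_le_iff)
      then have "{z \<in> \<psi> ` topspace Y. countable (supp_on S z)} \<subseteq> \<psi> ` C"
        by (auto simp: D_def)
      then have "\<psi> ` C = \<psi> ` topspace Y"
        by (intro image_eq_of_dense_subset[OF _ \<psi> Y C dense])
          (simp_all add: Hausdorff_space_product_topology)
      then obtain c where c: "c \<in> C" "\<psi> y = \<psi> c" using y by (metis imageE imageI)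
      then have "\<bar>f (x, c) - f (x', c)\<bar> \<le> 6 * \<delta>" "c \<in> topspace Y" by (auto simp: C_def)
      moreover have "\<bar>f (x, y) - f (x, c)\<bar> \<le> \<delta>" "\<bar>f (x', y) - f (x', c)\<bar> \<le> \<delta>"
        using fib c y U \<open>c \<in> topspace Y\<close> by auto
      ultimately show False using y(4) by linarith
    qed
  qed
  \<comment> \<open>The coordinates of index at most \<open>n\<close> in an enumeration of the
    support of each point of \<open>A\<close>: a finite set in which every such coordinate
    eventually appears. Intersecting with \<open>S\<close> discards the arbitrary value of
    \<open>from_nat_into\<close> on an empty support.\<close>
  define F where "F n A = S \<inter> (\<Union>a\<in>A. from_nat_into (supp_on S (\<psi> a)) ` {..n})" for n :: nat and A
  have finF: "finite (F n A)" if "finite A" for n A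
    using that by (simp add: F_def)
  \<comment> \<open>The gap \<open>2 * \<delta>\<close> survives in the limit as a weak inequality
    and still exceeds the bound \<open>\<delta>\<close> of \<open>fib\<close>.\<close>
  define good where "good n A U y z \<longleftrightarrow> y \<in> D \<and> z \<in> D \<and>
      (\<forall>s\<in>F n A. \<bar>\<psi> y s - \<psi> z s\<bar> < 1 / Suc n) \<and> (\<forall>x\<in>U. \<bar>f (x, y) - f (x, z)\<bar> > 2 * \<delta>)"
    for n A U y z
  \<comment> \<open>The order matters: first the finite net \<open>N\<close>, then a set
    \<open>U\<close> on which every section at a point of \<open>N\<close> varies by less than
    \<open>\<delta>\<close>, then a \<open>y\<close> oscillating on \<open>U\<close>. If
    \<open>y\<close> stayed within \<open>2 * \<delta>\<close> of its approximant \<open>d\<close>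
    at both \<open>x\<close> and \<open>x'\<close>, its oscillation would be below
    \<open>5 * \<delta>\<close>.\<close>
  have ex_good: "\<exists>U y z. openin X U \<and> U \<noteq> {} \<and> U \<subseteq> V \<and> good n A U y z"
    if V: "openin X V" "V \<noteq> {}" "V \<subseteq> W" and A: "finite A" for n A V
  proof -
    obtain N where N: "finite N" "N \<subseteq> D"
      "\<And>y. y \<in> D \<Longrightarrow> \<exists>d\<in>N. \<forall>s\<in>F n A. \<bar>\<psi> y s - \<psi> d s\<bar> < 1 / Suc n"
      using compact_space_finite_approximation[OF Y finF[OF A, of n] DY, of "\<lambda>s y. \<psi> y s" "1 / Suc n"]
        cont\<psi> by (metis (no_types, lifting) F_def IntD1 of_nat_0_less_iff zero_less_Suc zero_less_divide_1_iff)
    obtain U where U: "openin X U" "U \<noteq> {}" "U \<subseteq> V"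
      "\<And>d x x'. \<lbrakk>d \<in> N; x \<in> U; x' \<in> U\<rbrakk> \<Longrightarrow> \<bar>f (x, d) - f (x', d)\<bar> < \<delta>"
      using finite_continuous_small_oscillation[OF N(1) _ V(1,2) \<delta>, of "\<lambda>d x. f (x, d)"] contX N(2) DY
      by blast
    obtain y x x' where y: "y \<in> D" "x \<in> U" "x' \<in> U" "\<bar>f (x, y) - f (x', y)\<bar> > 6 * \<delta>"
      using oscD[of U] U V by blast
    obtain d where d: "d \<in> N" "\<forall>s\<in>F n A. \<bar>\<psi> y s - \<psi> d s\<bar> < 1 / Suc n"
      using N(3)[OF y(1)] by blast
    have dD: "d \<in> D" using d N by blast
    define U' where "U' = {x \<in> U. \<bar>f (x, y) - f (x, d)\<bar> \<in> {2 * \<delta><..}}"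
    have "openin X U'"
      unfolding U'_def using y dD DY
      by (intro openin_continuous_map_preimage_gen[where Y=euclideanreal] U continuous_map_real_abs
          continuous_map_diff contX) auto
    moreover have "U' \<noteq> {}"
    proof -
      have "\<bar>f (x, d) - f (x', d)\<bar> < \<delta>" using U d y by blast
      then have "\<bar>f (x, y) - f (x, d)\<bar> > 2 * \<delta> \<or> \<bar>f (x', y) - f (x', d)\<bar> > 2 * \<delta>"
        using y(4) \<delta> by linarith
      then show ?thesis using y by (auto simp: U'_def)
    qed
    moreover have "good n A U' y d"
      using y d dD by (auto simp: good_def U'_def)
    ultimately show ?thesis using U by (intro exI[of _ U'] exI[of _ y] exI[of _ d]) (auto simp: U'_def)
  qed
  \<comment> \<open>A state holds the round number, the current set of \<beta> and the finitely many
    points of \<open>Y\<close> chosen so far.\<close>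
  define I where "I = (\<lambda>(n :: nat, U, A). openin X U \<and> U \<noteq> {} \<and> U \<subseteq> W \<and> finite (A :: 'y set))"
  define R where "R = (\<lambda>(n, U :: 'a set, A) (P :: 'a set) (n', U', A').
    \<exists>y z. n' = Suc n \<and> A' = A \<union> {y, z} \<and> good n A U' y z)"
  obtain st P x where st0: "st 0 = (0, W, {})" and "\<And>n. I (st n)" and "\<And>n. P n \<in> \<P>"
    and stR: "\<And>n. R (st n) (P n) (st (Suc n))" and x: "\<And>n. x \<in> fst (snd (st n))"
  proof (rule beta_unfavorable_play[OF unf, of I "(0, W, {})" "\<lambda>s. fst (snd s)" R])
    show "I (0, W, {})" using W by (auto simp: I_def)
    show "openin X (fst (snd s)) \<and> fst (snd s) \<noteq> {}" if "I s" for s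
      using that by (auto simp: I_def)
    fix s V and P :: "'a set"
    assume s: "I s" and V: "openin X V" "V \<noteq> {}" "V \<subseteq> fst (snd s)"
    obtain n U A where nU: "s = (n, U, A)" using prod_cases3 by blast
    have VW: "V \<subseteq> W" and A: "finite A" using s V by (auto simp: nU I_def)
    obtain U' y z where "openin X U'" "U' \<noteq> {}" "U' \<subseteq> V" "good n A U' y z"
      using ex_good[OF V(1,2) VW A, of n] by blast
    then show "\<exists>s'. I s' \<and> fst (snd s') \<subseteq> V \<and> R s P s'"
      using VW A by (intro exI[of _ "(Suc n, U', A \<union> {y, z})"]) (auto simp: I_def R_def nU)
  qed blast
  have fst: "fst (st n) = n" for n
    by (induction n) (use st0 stR in \<open>auto simp: R_def split_beta\<close>)
  define A where "A n = snd (snd (st n))" for n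
  have "\<exists>y z. A (Suc n) = A n \<union> {y, z} \<and> good n (A n) (fst (snd (st (Suc n)))) y z" for n
    using stR[of n] by (auto simp: R_def split_beta fst A_def)
  then obtain y z where A_Suc: "\<And>n. A (Suc n) = A n \<union> {y n, z n}"
    and good: "\<And>n. good n (A n) (fst (snd (st (Suc n)))) (y n) (z n)"
    by metis
  have yz: "y n \<in> D" "z n \<in> D" "\<bar>f (x, y n) - f (x, z n)\<bar> > 2 * \<delta>"
    "s \<in> F n (A n) \<Longrightarrow> \<bar>\<psi> (y n) s - \<psi> (z n) s\<bar> < 1 / Suc n" for n s
    using good[of n] x[of "Suc n"] by (auto simp: good_def)
  have "mono A" by (auto simp: mono_iff_le_Suc A_Suc)
  have inA: "y k \<in> A n" "z k \<in> A n" if "k < n" for k n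
    using monoD[OF \<open>mono A\<close>, of "Suc k" n] that A_Suc[of k] by auto
  have xW: "x \<in> W" "x \<in> topspace X" using x[of 0] st0 WX by auto
  have yz_in: "(y n, z n) \<in> topspace (prod_topology Y Y)" for n using yz(1,2) DY by auto
  have YY: "compact_space (prod_topology Y Y)"
    using Y by (simp add: compact_space_prod_topology)
  obtain p where p: "p \<in> topspace (prod_topology Y Y)"
    and clu: "\<forall>C N. closedin (prod_topology Y Y) C \<and> (\<forall>n\<ge>N. (y n, z n) \<in> C) \<longrightarrow> p \<in> C"
    using compact_space_cluster_point[OF YY yz_in] by (rule bexE)
  have clu_real: "g p \<in> C"
    if "continuous_map (prod_topology Y Y) euclideanreal g" "closed C" "\<And>n. n \<ge> N \<Longrightarrow> g (y n, z n) \<in> C"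
    for g C N
    using clu[rule_format, of "{q \<in> topspace (prod_topology Y Y). g q \<in> C}" N]
      closedin_continuous_map_preimage[OF that(1), of C] that(2,3) yz_in by auto
  obtain a b where ab: "p = (a, b)" "a \<in> topspace Y" "b \<in> topspace Y" using p by auto
  have 1: "continuous_map (prod_topology Y Y) euclideanreal (\<lambda>q. g (fst q))"
    "continuous_map (prod_topology Y Y) euclideanreal (\<lambda>q. g (snd q))"
    if "continuous_map Y euclideanreal g" for g
    using continuous_map_compose[OF continuous_map_fst that] continuous_map_compose[OF continuous_map_snd that]
    by (auto simp: o_def)
  have "\<bar>f (x, fst p) - f (x, snd p)\<bar> \<in> {2 * \<delta>..}"
    by (rule clu_real[where N=0]) (intro continuous_map_real_abs continuous_map_diff 1 contY xW,
        use yz(3) in \<open>auto intro: less_imp_le\<close>)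
  moreover have "\<psi> a s = \<psi> b s" if s: "s \<in> S" for s
  \<comment> \<open>A coordinate in the support of some chosen point is controlled from some round
    on; every other coordinate vanishes at all chosen points.\<close>
  proof (cases "\<exists>k. s \<in> supp_on S (\<psi> (y k)) \<or> s \<in> supp_on S (\<psi> (z k))")
    case True
    then obtain k v where v: "v = y k \<or> v = z k" "s \<in> supp_on S (\<psi> v)" by blast
    then have "countable (supp_on S (\<psi> v))" using yz(1,2) by (auto simp: D_def)
    then obtain j where j: "s = from_nat_into (supp_on S (\<psi> v)) j"
      using v(2) from_nat_into_surj by metis
    \<comment> \<open>\<open>n > k\<close> puts \<open>v\<close> into \<open>A n\<close>, and
      \<open>n \<ge> j\<close> brings \<open>s\<close> into the enumerated part of its
      support.\<close>
    have close: "\<bar>\<psi> (y n) s - \<psi> (z n) s\<bar> < 1 / Suc n" if "n \<ge> max (Suc k) j" for n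
    proof (rule yz(4))
      have "v \<in> A n" using inA[of k n] v that by auto
      then show "s \<in> F n (A n)" using s j that by (auto simp: F_def)
    qed
    have "\<bar>\<psi> (fst p) s - \<psi> (snd p) s\<bar> \<in> {..1 / Suc N}" for N
    proof (rule clu_real[where N="max N (max (Suc k) j)"])
      fix n assume n: "n \<ge> max N (max (Suc k) j)"
      then have "1 / real (Suc n) \<le> 1 / Suc N" by (intro divide_left_mono) auto
      then show "\<bar>\<psi> (fst (y n, z n)) s - \<psi> (snd (y n, z n)) s\<bar> \<in> {..1 / Suc N}"
        using close[of n] n by auto
    qed (intro continuous_map_real_abs continuous_map_diff 1 cont\<psi> s, simp)
    then have "\<bar>\<psi> a s - \<psi> b s\<bar> \<le> 1 / Suc N" for N by (simp add: ab)
    then have "\<not> \<bar>\<psi> a s - \<psi> b s\<bar> > 0"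
      using nat_approx_posE by (metis not_less)
    then show ?thesis by simp
  next
    case False
    then have "\<psi> (y n) s = 0" "\<psi> (z n) s = 0" for n using s by (auto simp: supp_on_def)
    then have "\<psi> (fst p) s - \<psi> (snd p) s \<in> {0}"
      by (intro clu_real[where N=0 and C="{0}" and g="\<lambda>q. \<psi> (fst q) s - \<psi> (snd q) s"]
          continuous_map_diff 1 cont\<psi> s) auto
    then show ?thesis by (simp add: ab)
  qed
  \<comment> \<open>Extensionality turns agreement on \<open>S\<close> into
    \<open>\<psi> a = \<psi> b\<close>, so \<open>fib\<close> applies to the limit pair.\<close>
  moreover have "\<psi> a \<in> extensional S" "\<psi> b \<in> extensional S"
    using continuous_map_image_subset_topspace[OF \<psi>] ab by (auto simp: PiE_def)
  ultimately show False
    using fib[OF ab(2,3) _ xW(1)] \<delta> extensionalityI[of "\<psi> a" S "\<psi> b"] by (auto simp: ab)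
qed

section \<open>Valdivia compacts from separately continuous functions\<close>

text \<open>The sections of \<open>f\<close> at points of \<open>Y\<close> form a compact subset of
  \<open>Cp X\<close>. The map \<open>\<psi>\<close> restricts a section to \<open>E\<close> and
  then applies the homeomorphism from the Valdivia property, whose injectivity gives the last
  claim.\<close>

lemma valdivia_restriction:
  fixes f :: "'a \<times> 'y \<Rightarrow> real"
  assumes Y: "compact_space Y" and f: "separately_continuous X Y f" and E: "E \<subseteq> topspace X"
    and val: "\<And>K. compactin (Cp X) K \<Longrightarrow> valdivia_compact TYPE('s)
      (subtopology (Cp (subtopology X E)) ((\<lambda>y. restrict y E) ` K))"
  obtains S :: "'s set" and \<psi> where "continuous_map Y (powertop_real S) \<psi>"
    "dense_in (subtopology (powertop_real S) (\<psi> ` topspace Y))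
      {z \<in> \<psi> ` topspace Y. countable (supp_on S z)}"
    "\<And>y z e. \<lbrakk>y \<in> topspace Y; z \<in> topspace Y; \<psi> y = \<psi> z; e \<in> E\<rbrakk> \<Longrightarrow> f (e, y) = f (e, z)"
proof -
  have contY: "continuous_map Y euclideanreal (\<lambda>y. f (x, y))" if "x \<in> topspace X" for x
    using f that by (auto simp: separately_continuous_def)
  have contX: "continuous_map X euclideanreal (\<lambda>x. f (x, y))" if "y \<in> topspace Y" for y
    using f that by (auto simp: separately_continuous_def)
  \<comment> \<open>Needed twice: \<open>topspace X\<close> gives compactness of \<open>K\<close>,
    and \<open>E\<close> gives continuity of \<open>g\<close>.\<close>
  have cont: "continuous_map Y (Cp (subtopology X T)) (\<lambda>y. restrict (\<lambda>x. f (x, y)) T)"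
    if T: "T \<subseteq> topspace X" for T
    unfolding Cp_def
  proof (rule continuous_map_into_subtopology)
    have T': "topspace (subtopology X T) = T" using T by auto
    show "continuous_map Y (powertop_real (topspace (subtopology X T))) (\<lambda>y. restrict (\<lambda>x. f (x, y)) T)"
      unfolding T' continuous_map_componentwise using contY T by auto
    show "(\<lambda>y. restrict (\<lambda>x. f (x, y)) T) \<in> topspace Y \<rightarrow> {g. continuous_map (subtopology X T) euclideanreal g}"
    proof (intro Pi_I CollectI)
      fix y assume "y \<in> topspace Y"
      then have "continuous_map (subtopology X T) euclideanreal (\<lambda>x. f (x, y))"
        by (intro continuous_map_from_subtopology contX)
      then show "continuous_map (subtopology X T) euclideanreal (restrict (\<lambda>x. f (x, y)) T)"
        by (rule continuous_map_eq) auto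
    qed
  qed
  define K where "K = (\<lambda>y. restrict (\<lambda>x. f (x, y)) (topspace X)) ` topspace Y"
  have "compactin (Cp X) K"
    unfolding K_def using cont[of "topspace X"] Y
    by (intro image_compactin[of Y]) (auto simp: compact_space_def)
  define g where "g y = restrict (\<lambda>x. f (x, y)) E" for y
  have gK: "(\<lambda>y. restrict y E) ` K = g ` topspace Y"
    using E by (auto simp: K_def g_def image_image restrict_restrict Int_absorb1)
  define Z' where "Z' = subtopology (Cp (subtopology X E)) (g ` topspace Y)"
  have g: "continuous_map Y Z' g"
    unfolding Z'_def using cont[OF E] by (intro continuous_map_into_subtopology) (auto simp: g_def[abs_def])
  have Z': "topspace Z' = g ` topspace Y"
    using continuous_map_image_subset_topspace[OF g] by (auto simp: Z'_def)
  have "valdivia_compact TYPE('s) Z'"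
    using val[OF \<open>compactin (Cp X) K\<close>] by (simp add: Z'_def gK)
  then obtain S :: "'s set" and Z where Z: "compactin (powertop_real S) Z"
    "Z' homeomorphic_space subtopology (powertop_real S) Z"
    "dense_in (subtopology (powertop_real S) Z) {z \<in> Z. countable (supp_on S z)}"
    unfolding valdivia_compact_def by blast
  have ZT: "topspace (subtopology (powertop_real S) Z) = Z"
    using compactin_subset_topspace[OF Z(1)] by (auto)
  obtain h where h: "homeomorphic_map Z' (subtopology (powertop_real S) Z) h"
    using Z(2) by (auto simp: homeomorphic_space)
  have hc: "continuous_map Z' (subtopology (powertop_real S) Z) h"
    using h homeomorphic_imp_continuous_map by blast
  have him: "h ` topspace Z' = Z"
    using homeomorphic_imp_surjective_map[OF h] ZT by simp
  have inj: "inj_on h (topspace Z')"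
    using homeomorphic_imp_injective_map[OF h] .
  define \<psi> where "\<psi> = h \<circ> g"
  have im: "\<psi> ` topspace Y = Z" using him Z' by (auto simp: \<psi>_def image_comp)
  show ?thesis
  proof (rule that[of S \<psi>])
    show "continuous_map Y (powertop_real S) \<psi>"
      unfolding \<psi>_def using continuous_map_compose[OF g hc] continuous_map_in_subtopology by blast
    show "dense_in (subtopology (powertop_real S) (\<psi> ` topspace Y))
      {z \<in> \<psi> ` topspace Y. countable (supp_on S z)}"
      unfolding im by (rule Z(3))
    fix y z e assume *: "y \<in> topspace Y" "z \<in> topspace Y" "\<psi> y = \<psi> z" "e \<in> E"
    then have "g y = g z" using inj Z' by (auto simp: \<psi>_def inj_on_def)
    then show "f (e, y) = f (e, z)" using * unfolding g_def by (metis restrict_apply')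
  qed
qed

section \<open>Joint continuity from uniformly small oscillation\<close>

text \<open>By \<open>osc\<close>, the open sets of oscillation at most \<open>1 / Suc n\<close>,
  uniformly in \<open>y\<close>, have a dense union for each \<open>n\<close>. The Baire property
  makes the intersection of these unions dense, and there the uniform bound in \<open>x\<close>
  combines with continuity in \<open>y\<close>.\<close>

lemma namioka_property_if_small_oscillation:
  assumes baire: "baire_space X" and f: "separately_continuous X Y f"
    and osc: "\<And>W \<epsilon>. \<lbrakk>openin X W; W \<noteq> {}; \<epsilon> > 0\<rbrakk> \<Longrightarrow> \<exists>U. openin X U \<and> U \<noteq> {} \<and> U \<subseteq> W \<and>
      (\<forall>y\<in>topspace Y. \<forall>x\<in>U. \<forall>x'\<in>U. \<bar>f (x, y) - f (x', y)\<bar> \<le> \<epsilon>)"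
  shows "namioka_property X Y f"
proof -
  define small where "small \<epsilon> U \<longleftrightarrow> openin X U \<and>
    (\<forall>y\<in>topspace Y. \<forall>x\<in>U. \<forall>x'\<in>U. \<bar>f (x, y) - f (x', y)\<bar> \<le> \<epsilon>)" for \<epsilon> U
  define G where "G n = \<Union>{U. small (1 / Suc n) U}" for n :: nat
  have G: "openin X (G n)" for n by (auto simp: G_def small_def)
  have "dense_in X (G n)" for n
  proof -
    have "x \<in> X closure_of (G n)" if x: "x \<in> topspace X" for x
      unfolding in_closure_of
    proof (intro conjI allI impI x, elim conjE)
      fix W assume "x \<in> W" "openin X W"
      then obtain U where "small (1 / Suc n) U" "U \<noteq> {}" "U \<subseteq> W"
        using osc[of W "1 / Suc n"] unfolding small_def by fastforce
      then show "\<exists>y. y \<in> G n \<and> y \<in> W" by (auto simp: G_def)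
    qed
    then show ?thesis
      unfolding dense_in_def using openin_subset[OF G] closure_of_subset_topspace by fast
  qed
  then have "dense_in X (topspace X \<inter> \<Inter>(range G))"
    using baire[unfolded baire_space_def, rule_format, of "range G"] G by auto
  moreover have "topspace X \<inter> \<Inter>(range G) = \<Inter>(range G)"
    using openin_subset[OF G] by blast
  moreover have "gdelta_in X (\<Inter>(range G))"
    by (rule gdelta_in_Inter) (use G open_imp_gdelta_in in auto)
  moreover have "\<Inter>(range G) \<times> topspace Y \<subseteq> continuity_points X Y f"
  proof clarify
    fix x y assume x: "x \<in> \<Inter>(range G)" and y: "y \<in> topspace Y"
    have xX: "x \<in> topspace X" using x openin_subset[OF G] by blast
    have "\<exists>O'. openin (prod_topology X Y) O' \<and> (x, y) \<in> O' \<and> (\<forall>q\<in>O'. f q \<in> V)"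
      if V: "open V" "f (x, y) \<in> V" for V
    proof -
      obtain e where e: "e > 0" "ball (f (x, y)) e \<subseteq> V" using V by (meson openE)
      \<comment> \<open>Half of \<open>e\<close> pays for moving \<open>x\<close> to
        \<open>x'\<close> at fixed \<open>y'\<close>, the other half for moving \<open>y\<close> to
        \<open>y'\<close> at fixed \<open>x\<close>.\<close>
      then obtain n where n: "1 / Suc n < e / 2" by (meson half_gt_zero nat_approx_posE)
      obtain U where U: "small (1 / Suc n) U" "x \<in> U" using x by (auto simp: G_def)
      define T where "T = {y' \<in> topspace Y. f (x, y') \<in> ball (f (x, y)) (e/2)}"
      have "openin Y T"
        unfolding T_def using f xX
        by (intro openin_continuous_map_preimage[where Y=euclideanreal])
          (auto simp: separately_continuous_def)
      moreover have "f (x', y') \<in> V" if "x' \<in> U" "y' \<in> T" for x' y'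
      proof -
        have "\<bar>f (x', y') - f (x, y')\<bar> \<le> 1 / Suc n" using U that by (auto simp: small_def T_def)
        moreover have "\<bar>f (x, y) - f (x, y')\<bar> < e/2" using that by (auto simp: T_def dist_real_def)
        ultimately have "f (x', y') \<in> ball (f (x, y)) e" unfolding mem_ball dist_real_def using n by linarith
        then show ?thesis using e by blast
      qed
      moreover have "y \<in> T" using y e by (auto simp: T_def)
      ultimately show ?thesis
        using U by (intro exI[of _ "U \<times> T"]) (auto simp: openin_prod_Times_iff small_def)
    qed
    then show "(x, y) \<in> continuity_points X Y f"
      using xX y by (auto simp: continuity_points_def topcontinuous_at_def)
  qed
  ultimately show ?thesis unfolding namioka_property_def by metis
qed

section \<open>Pairs of points of \<open>Y\<close> that agree on the sets chosen by \<alpha>\<close>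

theorem theorem4p3:
  fixes X :: "'a topology"
  assumes "beta_v_unfavorable TYPE('s) X"
  shows "namioka_space TYPE('y) X"
proof -
  obtain \<P> where sub: "\<And>E. E \<in> \<P> \<Longrightarrow> E \<subseteq> topspace X"
    and un: "\<And>\<F>. \<lbrakk>finite \<F>; \<F> \<noteq> {}; \<F> \<subseteq> \<P>\<rbrakk> \<Longrightarrow> \<Union>\<F> \<in> \<P>"
    and val: "\<And>E K. \<lbrakk>E \<in> \<P>; compactin (Cp X) K\<rbrakk> \<Longrightarrow> valdivia_compact TYPE('s)
      (subtopology (Cp (subtopology X E)) ((\<lambda>y. restrict y E) ` K))"
    and unf: "beta_unfavorable X \<P>"
    using assms unfolding beta_v_unfavorable_def by (elim exE conjE) (rule that, simp_all)
  have baire: "baire_space X" by (rule beta_unfavorable_imp_baire[OF unf])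
  have "namioka_property X Y f" if Y: "compact_space Y" and f: "separately_continuous X Y f"
    for Y :: "'y topology" and f
  proof (rule namioka_property_if_small_oscillation[OF baire f], rule ccontr)
    fix W \<epsilon> assume W: "openin X W" "W \<noteq> {}" and \<epsilon>: "(\<epsilon> :: real) > 0"
      and no: "\<nexists>U. openin X U \<and> U \<noteq> {} \<and> U \<subseteq> W \<and>
        (\<forall>y\<in>topspace Y. \<forall>x\<in>U. \<forall>x'\<in>U. \<bar>f (x, y) - f (x', y)\<bar> \<le> \<epsilon>)"
    have contY: "continuous_map Y euclideanreal (\<lambda>y. f (x, y))" if "x \<in> topspace X" for x
      using f that by (auto simp: separately_continuous_def)
    have contX: "continuous_map X euclideanreal (\<lambda>x. f (x, y))" if "y \<in> topspace Y" for y
      using f that by (auto simp: separately_continuous_def)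
    \<comment> \<open>Chosen so that the failure of \<open>\<epsilon>\<close> is exactly the
      oscillation \<open>8 * \<delta>\<close> of
      \<open>separated_pair_in_valdivia_fibre\<close>.\<close>
    define \<delta> where "\<delta> = \<epsilon> / 8"
    have \<delta>: "\<delta> > 0" using \<epsilon> by (simp add: \<delta>_def)
    have osc: "\<exists>y\<in>topspace Y. \<exists>x\<in>U. \<exists>x'\<in>U. \<bar>f (x, y) - f (x', y)\<bar> > 8 * \<delta>"
      if "openin X U" "U \<noteq> {}" "U \<subseteq> W" for U
      using no that by (simp add: \<delta>_def) (meson not_le)
    define good where "good E U y z \<longleftrightarrow> y \<in> topspace Y \<and> z \<in> topspace Y \<and>
      (\<forall>e\<in>E. f (e, y) = f (e, z)) \<and> (\<forall>x\<in>U. \<bar>f (x, y) - f (x, z)\<bar> > \<delta>)" for E U y z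
    have ex_good: "\<exists>U y z. openin X U \<and> U \<noteq> {} \<and> U \<subseteq> V \<and> good E U y z"
      if V: "openin X V" "V \<noteq> {}" "V \<subseteq> W" and E: "E \<in> \<P>" for V E
    proof -
      obtain S :: "'s set" and \<psi> where \<psi>: "continuous_map Y (powertop_real S) \<psi>"
        "dense_in (subtopology (powertop_real S) (\<psi> ` topspace Y))
          {z \<in> \<psi> ` topspace Y. countable (supp_on S z)}"
        "\<And>y z e. \<lbrakk>y \<in> topspace Y; z \<in> topspace Y; \<psi> y = \<psi> z; e \<in> E\<rbrakk> \<Longrightarrow> f (e, y) = f (e, z)"
        using valdivia_restriction[OF Y f sub[OF E] val[OF E]] by blast
      \<comment> \<open>Open subsets of \<open>V\<close> are open subsets of \<open>W\<close>, so
        large oscillation persists and \<open>V\<close> can take the place of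
        \<open>W\<close>.\<close>
      have "\<exists>y\<in>topspace Y. \<exists>z\<in>topspace Y. \<psi> y = \<psi> z \<and> (\<exists>x\<in>V. \<bar>f (x, y) - f (x, z)\<bar> > \<delta>)"
        by (rule separated_pair_in_valdivia_fibre[OF unf Y f \<psi>(1,2) \<delta> V(1,2)])
          (use osc V in blast)
      then obtain y z x where yz: "y \<in> topspace Y" "z \<in> topspace Y" "\<psi> y = \<psi> z"
        and x: "x \<in> V" "\<bar>f (x, y) - f (x, z)\<bar> > \<delta>" by blast
      \<comment> \<open>The strict inequality at one point spreads to an open set by continuity of
        the two sections; \<beta> plays this set.\<close>
      define U where "U = {x \<in> V. \<bar>f (x, y) - f (x, z)\<bar> \<in> {\<delta><..}}"
      have "openin X U"
        unfolding U_def
        by (intro openin_continuous_map_preimage_gen[where Y=euclideanreal] V continuous_map_real_abs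
            continuous_map_diff contX yz) auto
      moreover have "good E U y z" using yz \<psi>(3)[OF yz] by (simp add: good_def U_def)
      moreover have "U \<noteq> {}" "U \<subseteq> V" using x by (auto simp: U_def)
      ultimately show ?thesis by blast
    qed
    define I where "I = (\<lambda>(U, E). openin X U \<and> U \<noteq> {} \<and> U \<subseteq> W \<and> (E = {} \<or> E \<in> \<P>))"
    define R where "R = (\<lambda>(U :: 'a set, E) P (U', E'). E' = E \<union> P \<and> (\<exists>y z. good E' U' y z))"
    obtain st P x where st0: "st 0 = (W, {})" and "\<And>n. I (st n)" and "\<And>n. P n \<in> \<P>"
      and stR: "\<And>n. R (st n) (P n) (st (Suc n))" and x: "\<And>n. x \<in> fst (st n)"
      and clo: "x \<in> X closure_of (\<Union>n. P n)"
    proof (rule beta_unfavorable_play[OF unf, of I "(W, {})" fst R])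
      show "I (W, {})" using W by (auto simp: I_def)
      show "openin X (fst s) \<and> fst s \<noteq> {}" if "I s" for s
        using that by (auto simp: I_def)
      fix s V P
      assume s: "I s" and V: "openin X V" "V \<noteq> {}" "V \<subseteq> fst s" and P: "P \<in> \<P>"
      obtain U E where UE: "s = (U, E)" by fastforce
      have VW: "V \<subseteq> W" using s V by (auto simp: UE I_def)
      have E: "E \<union> P \<in> \<P>" using s P un[of "{E, P}"] by (auto simp: UE I_def)
      obtain U' y z where "openin X U'" "U' \<noteq> {}" "U' \<subseteq> V" "good (E \<union> P) U' y z"
        using ex_good[OF V(1,2) VW E] by blast
      then show "\<exists>s'. I s' \<and> fst s' \<subseteq> V \<and> R s P s'"
        using VW E by (intro exI[of _ "(U', E \<union> P)"]) (auto simp: I_def R_def UE)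
    qed blast
    define E where "E n = snd (st n)" for n
    have E_Suc: "E (Suc n) = E n \<union> P n" for n
      using stR[of n] by (auto simp: R_def split_beta E_def)
    have "\<exists>y z. good (E (Suc n)) (fst (st (Suc n))) y z" for n
      using stR[of n] unfolding R_def split_beta E_def by metis
    then obtain y z where good: "\<And>n. good (E (Suc n)) (fst (st (Suc n))) (y n) (z n)"
      by metis
    \<comment> \<open>The index is \<open>Suc n\<close> because the pair is chosen after
      \<open>P n\<close> is known: it agrees on \<open>P 0, ..., P n\<close>.\<close>
    have yz: "y n \<in> topspace Y" "z n \<in> topspace Y" "\<bar>f (x, y n) - f (x, z n)\<bar> > \<delta>"
      "e \<in> E (Suc n) \<Longrightarrow> f (e, y n) = f (e, z n)" for n e
      using good[of n] x[of "Suc n"] by (auto simp: good_def)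
    have "mono E" by (auto simp: mono_iff_le_Suc E_Suc)
    have PE: "P k \<subseteq> E (Suc n)" if "k \<le> n" for k n
      using monoD[OF \<open>mono E\<close>, of "Suc k" "Suc n"] that E_Suc[of k] by auto
    have xX: "x \<in> topspace X" using clo by (simp add: in_closure_of)
    have yz_in: "(y n, z n) \<in> topspace (prod_topology Y Y)" for n using yz(1,2) by simp
    have YY: "compact_space (prod_topology Y Y)"
      using Y by (simp add: compact_space_prod_topology)
    obtain p where p: "p \<in> topspace (prod_topology Y Y)"
      and clu: "\<forall>C N. closedin (prod_topology Y Y) C \<and> (\<forall>n\<ge>N. (y n, z n) \<in> C) \<longrightarrow> p \<in> C"
      using compact_space_cluster_point[OF YY yz_in] by (rule bexE)
    obtain a b where ab: "p = (a, b)" "a \<in> topspace Y" "b \<in> topspace Y" using p by auto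
    have diff: "f (x', a) - f (x', b) \<in> C"
      if "x' \<in> topspace X" "closed C" "\<And>n. n \<ge> N \<Longrightarrow> f (x', y n) - f (x', z n) \<in> C" for x' C N
    proof -
      have "continuous_map (prod_topology Y Y) euclideanreal (\<lambda>q. f (x', fst q) - f (x', snd q))"
        using continuous_map_compose[OF continuous_map_fst contY[OF that(1)]]
          continuous_map_compose[OF continuous_map_snd contY[OF that(1)]]
        by (intro continuous_map_diff) (auto simp: o_def)
      from closedin_continuous_map_preimage[OF this, of C] show ?thesis
        using clu[rule_format, of "{q \<in> topspace (prod_topology Y Y).
            f (x', fst q) - f (x', snd q) \<in> C}" N] that(2,3) yz_in ab by auto
    qed
    \<comment> \<open>In the limit the strict gap becomes membership in two closed rays, which still
      exclude \<open>0\<close>.\<close>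
    have "f (x, a) - f (x, b) \<in> {..-\<delta>} \<union> {\<delta>..}"
    proof (rule diff[OF xX, where N=0])
      show "f (x, y n) - f (x, z n) \<in> {..-\<delta>} \<union> {\<delta>..}" for n
        using yz(3)[of n] by auto
    qed (intro closed_Un closed_atMost closed_atLeast)
    \<comment> \<open>On \<open>P k\<close> the pairs agree from round \<open>k\<close> on, so
      \<open>a\<close> and \<open>b\<close> give equal values on every \<open>P k\<close>.
      Continuity in the first variable extends this to the closure of their union, which contains
      \<open>x\<close> because \<beta> did not win the play.\<close>
    moreover have "f (x, a) - f (x, b) = 0"
    proof -
      have "f (e, a) - f (e, b) \<in> {0}" if e: "e \<in> P k" "e \<in> topspace X" for k e
      proof (rule diff[OF e(2), where N=k])
        show "f (e, y n) - f (e, z n) \<in> {0}" if "n \<ge> k" for n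
          using yz(4)[of e n] PE[OF that] e by auto
      qed auto
      then have "(\<Union>n. P n) \<subseteq> {x \<in> topspace X. f (x, a) - f (x, b) \<in> {0}}"
        using sub \<open>\<And>n. P n \<in> \<P>\<close> by blast
      moreover have "closedin X {x \<in> topspace X. f (x, a) - f (x, b) \<in> {0}}"
        by (intro closedin_continuous_map_preimage[where Y=euclideanreal] continuous_map_diff contX ab) auto
      ultimately show ?thesis using closure_of_minimal clo by fastforce
    qed
    ultimately show False using \<delta> by auto
  qed
  with baire show ?thesis unfolding namioka_space_def by blast
qed

end
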